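(* Suppose that $\sup_{q\in\mathbb{R}^n}\{\lambda_{\max}(M(q,\Theta))\}<\infty$ holds for all constant, physically consistent inertial parameters $\Theta=(\Phi_1^\top,\ldots,\Phi_N^\top)^\top\in\mathbb{R}^{10N}$ (i.e. whenever $f(\Phi_l)\succ0$ for all $l\in\{1,\ldots,N\}$), where $M(q,\Theta)=J(q)^\top\mathcal{Q}(q)^\top\mathcal{Z}(\Theta)\mathcal{Q}(q)J(q)$. If the time derivatives of the (time-dependent) inertial parameters $\Phi_1,\ldots,\Phi_N:[0,\infty)\to\mathbb{R}^{10}$ are bounded with $\sup_{t\ge0}\{\sigma_{\max}(f(\dot\Phi_l(t)))\}<\infty$ for all $l\in\{1,\ldots,N\}$, then the matrix $M(q,\dot\Theta)$ is uniformly bounded through a finite bound; specifically, the finite, nonnegative constant $$\chi=\sqrt{69N}\,\max_{l\in\{1,\ldots,N\}}\Big\{\sup_{t\ge0}\big\{\sigma_{\max}(f(\dot\Phi_l(t)))\big\}\Big\}\;\sup_{q\in\mathbb{R}^n}\big\{\sigma_{\max}(\mathcal{Q}(q)J(q))^2\big\}$$ then admits $\sigma_{\max}(M(q,\dot\Theta(t)))\le\chi$ for all $q\in\mathbb{R}^n$, $t\ge0$ (the maximum being finite due to the bounded rates of change and the last factor being finite due to the supposition on $M$).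
   Context: Notation: $\mathrm{I}_p$ is the $p\times p$ identity, $\mathrm{sym}(p)$ the real symmetric $p\times p$ matrices, $\lambda_{\max}$ the largest eigenvalue of a symmetric matrix, $\sigma_{\max}(B)=\sqrt{\lambda_{\max}(B^\top B)}$. For $x\in\mathbb{R}^3$, $\mathcal{S}(x)$ is the skew-symmetric $3\times3$ matrix with $\mathcal{S}(x)y=x\times y$ for all $y\in\mathbb{R}^3$. Kinematics: an open kinematic chain of $N$ bodies with generalized coordinates $q\in\mathbb{R}^n$. Kinematic parameters are constant (standing assumption), so the forward kinematic map $F:\mathbb{R}^n\to\mathbb{R}^{6N}$ depends only on $q$; write $F(q)=(F_{z_1}(q)^\top,F_{\phi_1}(q)^\top,\ldots,F_{z_N}(q)^\top,F_{\phi_N}(q)^\top)^\top$ with $F_{z_l},F_{\phi_l}\in\mathbb{R}^3$ (position of the origin and rotation angles of the $l$th body-fixed frame), and $J(q)=\partial F(q)/\partial q\in\mathbb{R}^{6N\times n}$. Rotation angles $\phi\in\mathbb{R}^3$ parameterize rotation matrices $\mathcal{R}(\phi)\in\mathrm{SO}(3)$, and $E(\phi)\in\mathbb{R}^{3\times3}$ is the matrix such that along any differentiable curve $\phi(t)$ one has $\mathcal{R}(\phi)^\top\dot{\mathcal{R}}(\phi)=\mathcal{S}(E(\phi)\dot\phi)$. Set $Q(\phi)=\mathrm{diag}(\mathcal{R}(\phi)^\top,E(\phi))\in\mathbb{R}^{6\times6}$ and $\mathcal{Q}(q)=\mathrm{diag}(Q(F_{\phi_1}(q)),\ldots,Q(F_{\phi_N}(q)))\in\mathbb{R}^{6N\times6N}$.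 Inertial parameters: $\Phi_l\in\mathbb{R}^{10}$ has entries, in order, $m_l,h_{1,l},h_{2,l},h_{3,l},I_{11,l},I_{22,l},I_{33,l},I_{12,l},I_{23,l},I_{13,l}$; $h_l=(h_{1,l},h_{2,l},h_{3,l})^\top$, and $I_l\in\mathrm{sym}(3)$ is the symmetric matrix with entries $I_{ij,l}$. $\Theta=(\Phi_1^\top,\ldots,\Phi_N^\top)^\top\in\mathbb{R}^{10N}$. Define the linear maps $$f(\Phi_l)=\begin{pmatrix}\frac12\mathrm{tr}(I_l)\mathrm{I}_3-I_l&h_l\\ h_l^\top&m_l\end{pmatrix}\in\mathrm{sym}(4),\qquad Z(\Phi_l)=\begin{pmatrix}m_l\mathrm{I}_3&-\mathcal{S}(h_l)\\ -\mathcal{S}(h_l)^\top&I_l\end{pmatrix}\in\mathrm{sym}(6),$$ $\mathcal{Z}(\Theta)=\mathrm{diag}(Z(\Phi_1),\ldots,Z(\Phi_N))$, and the mass matrix $$M(q,\Theta)=J(q)^\top\mathcal{Q}(q)^\top\mathcal{Z}(\Theta)\mathcal{Q}(q)J(q)\in\mathrm{sym}(n).$$ Inertial parameters may depend on time $t\ge0$ (differentiably); $\dot\Phi_l,\dot\Theta$ denote time derivatives, and $f(\dot\Phi_l)$, $M(q,\dot\Theta)$ denote the maps above evaluated at $\dot\Phi_l\in\mathbb{R}^{10}$, $\dot\Theta\in\mathbb{R}^{10N}$ in place of $\Phi_l,\Theta$. *)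

theory Defs
  imports "HOL-Analysis.Analysis"
begin

definition eigenvalues :: "real^'n^'n \<Rightarrow> real set" where
  "eigenvalues A = {k. \<exists>v. v \<noteq> 0 \<and> A *v v = k *s v}"

text \<open>Only meaningful for symmetric matrices, where the set of real eigenvalues is
  finite and nonempty.\<close>

definition lambda_max :: "real^'n^'n \<Rightarrow> real" where
  "lambda_max A = Max (eigenvalues A)"

definition sigma_max :: "real^'n^'m \<Rightarrow> real" where
  "sigma_max B = sqrt (lambda_max (transpose B ** B))"

definition pos_def :: "real^'n^'n \<Rightarrow> bool" where
  "pos_def A \<longleftrightarrow> transpose A = A \<and> (\<forall>x. x \<noteq> 0 \<longrightarrow> x \<bullet> (A *v x) > 0)"

definition skew :: "real^3 \<Rightarrow> real^3^3" where
  "skew x = matrix (cross3 x)"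

definition block :: "real^'c^'r \<Rightarrow> real^'d^'r \<Rightarrow> real^'c^'s \<Rightarrow> real^'d^'s \<Rightarrow> real^('c + 'd)^('r + 's)" where
  "block A B C D = (\<chi> i j. case i of
      Inl r \<Rightarrow> (case j of Inl c \<Rightarrow> A $ r $ c | Inr d \<Rightarrow> B $ r $ d)
    | Inr s \<Rightarrow> (case j of Inl c \<Rightarrow> C $ s $ c | Inr d \<Rightarrow> D $ s $ d))"

definition block_diag :: "('b::finite \<Rightarrow> real^'c^'r) \<Rightarrow> real^('b \<times> 'c)^('b \<times> 'r)" where
  "block_diag A = (\<chi> i j. if fst i = fst j then A (fst i) $ snd i $ snd j else 0)"

text \<open>A vector of inertial parameters of one body is ordered as
  m, h1, h2, h3, I11, I22, I33, I12, I23, I13. In the index type \<open>10\<close> the numerals 1 to 10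
  are distinct (10 coincides with 0).\<close>

definition ip_mass :: "real^10 \<Rightarrow> real" where
  "ip_mass p = p $ 1"

definition ip_moment :: "real^10 \<Rightarrow> real^3" where
  "ip_moment p = vector [p $ 2, p $ 3, p $ 4]"

definition ip_inertia :: "real^10 \<Rightarrow> real^3^3" where
  "ip_inertia p = vector [vector [p $ 5, p $ 8, p $ 10],
                          vector [p $ 8, p $ 6, p $ 9],
                          vector [p $ 10, p $ 9, p $ 7]]"

definition pseudo_inertia :: "real^10 \<Rightarrow> real^(3 + 1)^(3 + 1)" where
  "pseudo_inertia p =
     block (mat (trace (ip_inertia p) / 2) - ip_inertia p) (columnvector (ip_moment p))
           (rowvector (ip_moment p)) (mat (ip_mass p))"

definition spatial_inertia :: "real^10 \<Rightarrow> real^(3 + 3)^(3 + 3)" where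
  "spatial_inertia p =
     block (mat (ip_mass p)) (- skew (ip_moment p))
           (- transpose (skew (ip_moment p))) (ip_inertia p)"

text \<open>The stacked parameter vector of all bodies is kept as a vector of vectors:
  \<open>\<Theta> $ l\<close> holds the ten parameters of body \<open>l\<close>.\<close>

definition spatial_inertias :: "real^10^'b::finite \<Rightarrow> real^('b \<times> (3 + 3))^('b \<times> (3 + 3))" where
  "spatial_inertias \<Theta> = block_diag (\<lambda>l. spatial_inertia (\<Theta> $ l))"

text \<open>\<open>E\<close> is the matrix for which \<open>E(\<phi>) \<phi>'\<close> is the body-fixed angular velocity along
  every differentiable curve \<open>\<phi>\<close> of rotation angles.\<close>

definition angular_velocity_map ::
    "(real^3 \<Rightarrow> real^3^3) \<Rightarrow> (real^3 \<Rightarrow> real^3^3) \<Rightarrow> bool" where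
  "angular_velocity_map R E \<longleftrightarrow>
     (\<forall>\<phi> :: real \<Rightarrow> real^3. (\<forall>t. \<phi> differentiable (at t)) \<longrightarrow>
        (\<forall>t. transpose (R (\<phi> t)) ** vector_derivative (\<lambda>s. R (\<phi> s)) (at t)
               = skew (E (\<phi> t) *v vector_derivative \<phi> (at t))))"

text \<open>The coordinates of the forward kinematic map are indexed by body; \<open>Inl\<close> selects the
  position and \<open>Inr\<close> the rotation angles of the body-fixed frame.\<close>

definition angles_of :: "real^('b::finite \<times> (3 + 3)) \<Rightarrow> 'b \<Rightarrow> real^3" where
  "angles_of x l = (\<chi> k. x $ (l, Inr k))"

definition body_transform ::
    "(real^3 \<Rightarrow> real^3^3) \<Rightarrow> (real^3 \<Rightarrow> real^3^3) \<Rightarrow> real^3 \<Rightarrow> real^(3 + 3)^(3 + 3)" where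
  "body_transform R E \<phi> = block (transpose (R \<phi>)) 0 0 (E \<phi>)"

definition chain_transform ::
    "(real^3 \<Rightarrow> real^3^3) \<Rightarrow> (real^3 \<Rightarrow> real^3^3) \<Rightarrow> (real^'n \<Rightarrow> real^('b::finite \<times> (3 + 3)))
      \<Rightarrow> real^'n \<Rightarrow> real^('b \<times> (3 + 3))^('b \<times> (3 + 3))" where
  "chain_transform R E F q = block_diag (\<lambda>l. body_transform R E (angles_of (F q) l))"

definition mass_matrix ::
    "(real^3 \<Rightarrow> real^3^3) \<Rightarrow> (real^3 \<Rightarrow> real^3^3) \<Rightarrow> (real^'n \<Rightarrow> real^('b::finite \<times> (3 + 3)))
      \<Rightarrow> real^'n \<Rightarrow> real^10^'b \<Rightarrow> real^'n^'n" where
  "mass_matrix R E F q \<Theta> =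
     transpose (jacobian F (at q)) ** transpose (chain_transform R E F q)
       ** spatial_inertias \<Theta> ** chain_transform R E F q ** jacobian F (at q)"

end

(* The mass matrix is B^T Z B with B = QJ, so its spectral norm is at most |B|^2 times the Frobenius
   norm of Z. Every entry of the pseudo-inertia f(p) is at most s = sigma_max (f p) in modulus, and
   all entries of Z(p) are entries of f(p) up to sign, except for the diagonal of the inertia tensor,
   whose entries are sums of two of them; counting gives a squared Frobenius norm of at most
   (3 + 12 + 6 + 12) s^2 = 33 s^2 per body. The factor |B|^2 is finite because Z(p) is the identity
   for the physically consistent parameters m = 1, h = 0, I = identity, where the supposition on M
   bounds the largest eigenvalue of B^T B. *)

theory Submission
  imports Defs
begin

subsection \<open>Largest eigenvalues and singular values\<close>

lemma inner_transpose_mult_vec: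
  fixes B :: "real^'n^'m"
  shows "(transpose B *v y) \<bullet> x = y \<bullet> (B *v x)"
  by (simp add: transpose_matrix_vector dot_lmul_matrix)

lemma symmetric_inner_swap:
  fixes A :: "real^'n^'n"
  assumes "transpose A = A"
  shows "x \<bullet> (A *v y) = (A *v x) \<bullet> y"
  using inner_transpose_mult_vec[of A x y] assms by simp

text \<open>Eigenvectors of a symmetric matrix for distinct eigenvalues are orthogonal, so one
  eigenvector chosen per eigenvalue gives an independent set. Finiteness is what makes the
  \<open>Max\<close> in \<open>lambda_max\<close> meaningful.\<close>

lemma finite_eigenvalues:
  fixes A :: "real^'n^'n"
  assumes sym: "transpose A = A"
  shows "finite (eigenvalues A)"
proof -
  have "\<forall>k\<in>eigenvalues A. \<exists>v. v \<noteq> 0 \<and> A *v v = k *s v"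
    by (auto simp: eigenvalues_def)
  then obtain w where w: "\<And>k. k \<in> eigenvalues A \<Longrightarrow> w k \<noteq> 0 \<and> A *v w k = k *\<^sub>R w k"
    by (metis scalar_mult_eq_scaleR)
  have orth: "w k \<bullet> w l = 0" if "k \<in> eigenvalues A" "l \<in> eigenvalues A" "k \<noteq> l" for k l
  proof -
    have "l * (w k \<bullet> w l) = k * (w k \<bullet> w l)"
      using symmetric_inner_swap[OF sym, of "w k" "w l"] w that by simp
    with that show ?thesis by simp
  qed
  have inj: "inj_on w (eigenvalues A)"
    by (rule inj_onI) (metis inner_eq_zero_iff orth w)
  have "pairwise orthogonal (w ` eigenvalues A)"
    by (auto simp: pairwise_def orthogonal_def intro: orth)
  moreover have "0 \<notin> w ` eigenvalues A"
    using w by auto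
  ultimately have "independent (w ` eigenvalues A)"
    by (rule pairwise_orthogonal_independent)
  then have "finite (w ` eigenvalues A)"
    by (rule independent_imp_finite)
  with inj show ?thesis
    by (simp add: finite_image_iff)
qed

text \<open>First-order condition at a minimum: the polynomial vanishes at \<open>t = 0\<close> and
  is nonnegative everywhere, so its derivative there is zero.\<close>

lemma linear_coeff_eq_0:
  fixes a b :: real
  assumes "\<And>t. 0 \<le> 2 * t * a + t\<^sup>2 * b"
  shows "a = 0"
proof (rule ccontr)
  assume "a \<noteq> 0"
  \<comment> \<open>Any positive \<open>c\<close> with \<open>b < 2 * c\<close> works: at
    \<open>t = - a / c\<close> the quadratic equals \<open>(a / c)^2 * (b - 2 * c)\<close>, which is
    negative.\<close>
  define c where "c = \<bar>b\<bar> + 1"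
  have c: "c > 0" "b < 2 * c" by (auto simp: c_def)
  have "0 \<le> 2 * (- a / c) * a + (- a / c)\<^sup>2 * b"
    by (rule assms)
  also have "\<dots> = (a / c)\<^sup>2 * (b - 2 * c)"
    using c by (simp add: field_simps power2_eq_square)
  also have "\<dots> < 0"
    using c \<open>a \<noteq> 0\<close> by (intro mult_pos_neg) auto
  finally show False by simp
qed

text \<open>The form \<open>k * (x \<bullet> x) - x \<bullet> (A *v x)\<close> is nonnegative and
  vanishes at \<open>v\<close>, so its derivative at \<open>v\<close> is zero in every
  direction.\<close>

lemma rayleigh_maximum_eigenvector:
  fixes A :: "real^'n^'n"
  assumes sym: "transpose A = A"
    and bound: "\<And>x. x \<bullet> (A *v x) \<le> k * (x \<bullet> x)"
    and max: "v \<bullet> (A *v v) = k * (v \<bullet> v)"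
  shows "A *v v = k *s v"
proof -
  \<comment> \<open>Perturbing \<open>v\<close> along the residual itself makes the linear
    coefficient equal to \<open>r \<bullet> r\<close>.\<close>
  define r where "r = k *\<^sub>R v - A *v v"
  have "r \<bullet> r = 0"
  proof (rule linear_coeff_eq_0)
    fix t :: real
    have "0 \<le> k * ((v + t *\<^sub>R r) \<bullet> (v + t *\<^sub>R r)) - (v + t *\<^sub>R r) \<bullet> (A *v (v + t *\<^sub>R r))"
      using bound[of "v + t *\<^sub>R r"] by simp
    also have "\<dots> = 2 * t * (k * (v \<bullet> r) - (A *v v) \<bullet> r) + t\<^sup>2 * (k * (r \<bullet> r) - r \<bullet> (A *v r))"
      using max symmetric_inner_swap[OF sym, of v r] inner_commute[of r "A *v v"] inner_commute[of r v]
      by (simp add: matrix_vector_right_distrib matrix_vector_mult_scaleR inner_add_left inner_add_right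
          algebra_simps power2_eq_square)
    also have "k * (v \<bullet> r) - (A *v v) \<bullet> r = r \<bullet> r"
      by (simp add: r_def inner_diff_left)
    finally show "0 \<le> 2 * t * (r \<bullet> r) + t\<^sup>2 * (k * (r \<bullet> r) - r \<bullet> (A *v r))" .
  qed
  then show ?thesis
    by (simp add: r_def scalar_mult_eq_scaleR)
qed

text \<open>The quadratic form of the Gram matrix is the squared norm of \<open>B *v x\<close>. By
  compactness it attains its maximum on the unit sphere; the maximizer is an eigenvector for the
  squared operator norm, and no eigenvalue can exceed that bound on the form.\<close>

lemma lambda_max_gram:
  fixes B :: "real^'n^'m"
  shows "lambda_max (transpose B ** B) = (onorm ((*v) B))\<^sup>2"
proof -
  let ?A = "transpose B ** B" and ?s = "onorm ((*v) B)"
  have sym: "transpose ?A = ?A"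
    by (simp add: matrix_transpose_mul)
  have lin: "bounded_linear ((*v) B)"
    by (rule matrix_vector_mul_bounded_linear)
  have quad: "x \<bullet> (?A *v x) = (norm (B *v x))\<^sup>2" for x
    using inner_transpose_mult_vec[of B "B *v x" x]
    by (simp only: matrix_vector_mul_assoc[symmetric] power2_norm_eq_inner inner_commute)
  have bound: "x \<bullet> (?A *v x) \<le> ?s\<^sup>2 * (x \<bullet> x)" for x
  proof -
    have "(norm (B *v x))\<^sup>2 \<le> (?s * norm x)\<^sup>2"
      by (intro power_mono onorm lin norm_ge_zero)
    then show ?thesis
      by (simp only: quad power_mult_distrib power2_norm_eq_inner)
  qed
  have "\<exists>v\<in>sphere 0 1. \<forall>x\<in>sphere 0 1. norm (B *v x) \<le> norm (B *v v)"
    using linear_continuous_on[OF lin]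
    by (intro continuous_attains_sup continuous_on_norm) auto
  then obtain v where v: "norm v = 1" and vmax: "\<And>x. norm x = 1 \<Longrightarrow> norm (B *v x) \<le> norm (B *v v)"
    unfolding Ball_def Bex_def mem_sphere_0 by blast
  have "norm (B *v x) \<le> norm (B *v v) * norm x" for x
  proof (cases "x = 0")
    case False
    then have "norm (B *v (x /\<^sub>R norm x)) \<le> norm (B *v v)"
      by (intro vmax) simp
    with False show ?thesis
      by (simp add: matrix_vector_mult_scaleR field_simps)
  qed simp
  then have "?s \<le> norm (B *v v)"
    by (rule onorm_le)
  moreover have "norm (B *v v) \<le> ?s"
    using onorm[OF lin, of v] unfolding v by simp
  ultimately have "?s = norm (B *v v)"
    by (rule antisym)
  then have "?A *v v = ?s\<^sup>2 *s v"
    using v by (intro rayleigh_maximum_eigenvector[OF sym bound])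
      (simp add: quad flip: power2_norm_eq_inner)
  moreover have "v \<noteq> 0"
    using v by auto
  ultimately have "?s\<^sup>2 \<in> eigenvalues ?A"
    unfolding eigenvalues_def by blast
  moreover have "k \<le> ?s\<^sup>2" if k: "k \<in> eigenvalues ?A" for k
  proof -
    obtain x where x: "x \<noteq> 0" "?A *v x = k *\<^sub>R x"
      using k unfolding eigenvalues_def scalar_mult_eq_scaleR by blast
    then have "k * (x \<bullet> x) \<le> ?s\<^sup>2 * (x \<bullet> x)"
      using bound[of x] by (simp only: inner_scaleR_right)
    with x(1) show ?thesis
      by simp
  qed
  ultimately show ?thesis
    unfolding lambda_max_def using finite_eigenvalues[OF sym] by (intro Max_eqI) auto
qed

section \<open>Singular values as operator norms\<close>

lemma sigma_max_eq_onorm: "sigma_max B = onorm ((*v) B)"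
  by (simp add: sigma_max_def lambda_max_gram onorm_pos_le matrix_vector_mul_bounded_linear)

lemma sigma_max_nonneg: "0 \<le> sigma_max B"
  by (simp add: sigma_max_eq_onorm onorm_pos_le matrix_vector_mul_bounded_linear)

lemma norm_mult_vec_le_sigma_max: "norm (B *v x) \<le> sigma_max B * norm x"
  unfolding sigma_max_eq_onorm by (intro onorm matrix_vector_mul_bounded_linear)

lemma sigma_max_leI: "(\<And>x. norm (B *v x) \<le> c * norm x) \<Longrightarrow> sigma_max B \<le> c"
  unfolding sigma_max_eq_onorm by (rule onorm_le)

lemma abs_entry_le_sigma_max: "\<bar>A $ i $ j\<bar> \<le> sigma_max A"
  unfolding sigma_max_eq_onorm by (rule matrix_component_le_onorm)

text \<open>Pair \<open>transpose B *v y\<close> with itself, move \<open>B\<close> to the other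
  side, apply Cauchy-Schwarz and cancel one factor. This avoids comparing the spectra of the two
  Gram matrices of \<open>B\<close>.\<close>

lemma norm_transpose_mult_vec_le: "norm (transpose B *v y) \<le> sigma_max B * norm y"
proof -
  let ?z = "transpose B *v y"
  have "norm ?z * norm ?z = y \<bullet> (B *v ?z)"
    by (simp only: inner_transpose_mult_vec[symmetric] power2_eq_square[symmetric] power2_norm_eq_inner)
  also have "\<dots> \<le> norm y * norm (B *v ?z)"
    by (rule norm_cauchy_schwarz)
  also have "\<dots> \<le> norm y * (sigma_max B * norm ?z)"
    by (intro mult_left_mono norm_mult_vec_le_sigma_max) simp
  finally have "norm ?z * norm ?z \<le> (sigma_max B * norm y) * norm ?z"
    by (simp add: mult_ac)
  then show ?thesis
    by (cases "?z = 0") (auto simp: sigma_max_nonneg)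
qed

text \<open>The norm of type \<open>real^'n^'m\<close> is the Frobenius norm.\<close>

lemma power2_norm_matrix: "(norm (A :: real^'n^'m))\<^sup>2 = (\<Sum>i\<in>UNIV. \<Sum>j\<in>UNIV. (A $ i $ j)\<^sup>2)"
  unfolding power2_norm_eq_inner inner_vec_def by (simp add: power2_eq_square)

text \<open>Cauchy-Schwarz applied to each row, then summed over the rows.\<close>

lemma norm_mult_vec_le_norm:
  fixes A :: "real^'n^'m"
  shows "norm (A *v x) \<le> norm A * norm x"
proof (rule power2_le_imp_le)
  have "(norm (A *v x))\<^sup>2 = (\<Sum>i\<in>UNIV. (A $ i \<bullet> x)\<^sup>2)"
    unfolding power2_norm_eq_inner inner_vec_def[of "A *v x"]
    by (simp add: matrix_vector_mul_component power2_eq_square)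
  also have "\<dots> \<le> (\<Sum>i\<in>UNIV. (norm (A $ i))\<^sup>2 * (norm x)\<^sup>2)"
    by (intro sum_mono) (simp add: Cauchy_Schwarz_ineq power2_norm_eq_inner)
  also have "\<dots> = (norm A * norm x)\<^sup>2"
    unfolding power_mult_distrib power2_norm_eq_inner[of A] inner_vec_def[of A]
    by (simp add: sum_distrib_right power2_norm_eq_inner)
  finally show "(norm (A *v x))\<^sup>2 \<le> (norm A * norm x)\<^sup>2" .
qed simp

text \<open>The outer factors contribute \<open>sigma_max B\<close> each. The middle one is measured
  in the Frobenius norm, which can be read off entry by entry.\<close>

lemma sigma_max_congruence_le:
  fixes B :: "real^'n^'m" and Z :: "real^'m^'m"
  shows "sigma_max (transpose B ** Z ** B) \<le> norm Z * (sigma_max B)\<^sup>2"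
proof (rule sigma_max_leI)
  fix x
  have "norm ((transpose B ** Z ** B) *v x) = norm (transpose B *v (Z *v (B *v x)))"
    by (simp add: matrix_vector_mul_assoc matrix_mul_assoc)
  also have "\<dots> \<le> sigma_max B * (norm Z * (sigma_max B * norm x))"
    by (intro order_trans[OF norm_transpose_mult_vec_le] mult_left_mono
        order_trans[OF norm_mult_vec_le_norm] norm_mult_vec_le_sigma_max sigma_max_nonneg norm_ge_zero)
  finally show "norm ((transpose B ** Z ** B) *v x) \<le> norm Z * (sigma_max B)\<^sup>2 * norm x"
    by (simp add: power2_eq_square mult_ac)
qed

subsection \<open>Block matrices\<close>

lemma sum_UNIV_sum: "(\<Sum>i\<in>UNIV. f i) = (\<Sum>i\<in>UNIV. f (Inl i)) + (\<Sum>i\<in>UNIV. f (Inr i))"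
  for f :: "'a::finite + 'c::finite \<Rightarrow> 'd::comm_monoid_add"
  by (simp add: sum.Plus comp_def flip: UNIV_Plus_UNIV)

lemma power2_norm_block:
  "(norm (block A B C D))\<^sup>2 = (norm A)\<^sup>2 + (norm B)\<^sup>2 + (norm C)\<^sup>2 + (norm D)\<^sup>2"
  by (simp add: power2_norm_matrix block_def sum_UNIV_sum sum.distrib)

lemma power2_norm_block_diag: "(norm (block_diag A))\<^sup>2 = (\<Sum>l\<in>UNIV. (norm (A l))\<^sup>2)"
proof -
  have "(\<Sum>j\<in>UNIV. (block_diag A $ (l, r) $ j)\<^sup>2) = (\<Sum>c\<in>UNIV. (A l $ r $ c)\<^sup>2)" for l r
  proof -
    \<comment> \<open>Split the column index into block \<open>k\<close> and position
      \<open>c\<close>; only the block \<open>k = l\<close> survives.\<close>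
    have "(\<Sum>j\<in>UNIV. (block_diag A $ (l, r) $ j)\<^sup>2)
        = (\<Sum>k\<in>UNIV. if l = k then \<Sum>c\<in>UNIV. (A l $ r $ c)\<^sup>2 else 0)"
      unfolding UNIV_Times_UNIV[symmetric] sum.cartesian_product'
      by (intro sum.cong refl) (simp add: block_diag_def)
    then show ?thesis by simp
  qed
  then show ?thesis
    unfolding power2_norm_matrix UNIV_Times_UNIV[symmetric] sum.cartesian_product' by simp
qed

lemma block_mat: "block (mat a) 0 0 (mat a) = mat a"
  by (auto simp: block_def mat_def vec_eq_iff split: sum.splits)

lemma block_diag_mat: "block_diag (\<lambda>_. mat a) = mat a"
  by (auto simp: block_diag_def mat_def vec_eq_iff prod_eq_iff)

subsection \<open>Inertia matrices\<close>

lemma power2_norm_vec_3: "(norm (x :: real^3))\<^sup>2 = (x $ 1)\<^sup>2 + (x $ 2)\<^sup>2 + (x $ 3)\<^sup>2"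
  unfolding power2_norm_eq_inner inner_vec_def by (simp add: sum_3 power2_eq_square)

text \<open>Each component of \<open>h\<close> occurs twice up to sign, and the diagonal is
  zero.\<close>

lemma power2_norm_skew: "(norm (skew h))\<^sup>2 = 2 * (norm h)\<^sup>2"
  by (simp add: power2_norm_matrix power2_norm_vec_3 skew_def matrix_def cross3_def sum_3 axis_def)

lemma power2_norm_spatial_inertia_le:
  assumes "\<And>i j. \<bar>pseudo_inertia p $ i $ j\<bar> \<le> s"
  shows "(norm (spatial_inertia p))\<^sup>2 \<le> 33 * s\<^sup>2"
proof -
  let ?f = "pseudo_inertia p"
  have sq: "(?f $ i $ j)\<^sup>2 \<le> s\<^sup>2" for i j
    using power_mono[OF assms[of i j], of 2] by simp
  \<comment> \<open>Meant for the moments of inertia: each diagonal entry of the upper left block is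
    half the trace minus one moment, so two of them sum to the third moment.\<close>
  have sum_sq: "(?f $ i $ i + ?f $ j $ j)\<^sup>2 \<le> 4 * s\<^sup>2" for i j
  proof -
    have "\<bar>?f $ i $ i + ?f $ j $ j\<bar> \<le> 2 * s"
      using assms[of i i] assms[of j j] by linarith
    from power_mono[OF this, of 2] show ?thesis
      by (simp add: power_mult_distrib)
  qed
  note entries = pseudo_inertia_def block_def mat_def ip_inertia_def ip_moment_def ip_mass_def
    columnvector_def rowvector_def trace_def sum_3
  have m: "(p $ 1)\<^sup>2 \<le> s\<^sup>2"
    using sq[of "Inr 1" "Inr 1"] by (simp add: entries)
  have h: "(p $ 2)\<^sup>2 \<le> s\<^sup>2" "(p $ 3)\<^sup>2 \<le> s\<^sup>2" "(p $ 4)\<^sup>2 \<le> s\<^sup>2"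
    using sq[of "Inl 1" "Inr 1"] sq[of "Inl 2" "Inr 1"] sq[of "Inl 3" "Inr 1"]
    by (simp_all add: entries)
  have off: "(p $ 8)\<^sup>2 \<le> s\<^sup>2" "(p $ 9)\<^sup>2 \<le> s\<^sup>2" "(p $ 10)\<^sup>2 \<le> s\<^sup>2"
    using sq[of "Inl 1" "Inl 2"] sq[of "Inl 2" "Inl 3"] sq[of "Inl 1" "Inl 3"]
    by (simp_all add: entries)
  have diag: "(p $ 5)\<^sup>2 \<le> 4 * s\<^sup>2" "(p $ 6)\<^sup>2 \<le> 4 * s\<^sup>2" "(p $ 7)\<^sup>2 \<le> 4 * s\<^sup>2"
    using sum_sq[of "Inl 2" "Inl 3"] sum_sq[of "Inl 1" "Inl 3"] sum_sq[of "Inl 1" "Inl 2"]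
    by (simp_all add: entries field_simps)
  have transp: "(norm (transpose A))\<^sup>2 = (norm A)\<^sup>2" for A :: "real^3^3"
    by (simp add: power2_norm_matrix transpose_def sum_3)
  \<comment> \<open>The mass fills a diagonal of length 3; the factor 4 comes from two skew blocks,
    each counting the moment vector twice.\<close>
  have "(norm (spatial_inertia p))\<^sup>2 = 3 * (p $ 1)\<^sup>2 + 4 * (norm (ip_moment p))\<^sup>2 + (norm (ip_inertia p))\<^sup>2"
    by (simp add: spatial_inertia_def power2_norm_block transp power2_norm_skew)
      (simp add: power2_norm_matrix mat_def sum_3 ip_mass_def)
  also have "(norm (ip_moment p))\<^sup>2 = (p $ 2)\<^sup>2 + (p $ 3)\<^sup>2 + (p $ 4)\<^sup>2"
    by (simp add: power2_norm_vec_3 ip_moment_def)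
  also have "(norm (ip_inertia p))\<^sup>2 =
      (p $ 5)\<^sup>2 + (p $ 6)\<^sup>2 + (p $ 7)\<^sup>2 + 2 * ((p $ 8)\<^sup>2 + (p $ 9)\<^sup>2 + (p $ 10)\<^sup>2)"
    by (simp add: power2_norm_matrix sum_3 ip_inertia_def)
  finally show ?thesis
    using m h off diag by simp
qed

lemma norm_spatial_inertias_le:
  fixes \<Theta> :: "real^10^'b::finite"
  assumes "\<And>l. sigma_max (pseudo_inertia (\<Theta> $ l)) \<le> s"
  shows "norm (spatial_inertias \<Theta>) \<le> sqrt (69 * real CARD('b)) * s"
proof (rule power2_le_imp_le)
  have s: "0 \<le> s"
    using order_trans[OF sigma_max_nonneg assms] .
  then show "0 \<le> sqrt (69 * real CARD('b)) * s"
    by simp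
  have "(norm (spatial_inertias \<Theta>))\<^sup>2 \<le> (\<Sum>l\<in>(UNIV :: 'b set). 33 * s\<^sup>2)"
    unfolding spatial_inertias_def power2_norm_block_diag
    by (intro sum_mono power2_norm_spatial_inertia_le order_trans[OF abs_entry_le_sigma_max assms])
  \<comment> \<open>The count of 33 per body is relaxed to the constant 69 of the claim.\<close>
  also have "\<dots> \<le> 69 * real CARD('b) * s\<^sup>2"
    by (simp add: mult_right_mono)
  finally show "(norm (spatial_inertias \<Theta>))\<^sup>2 \<le> (sqrt (69 * real CARD('b)) * s)\<^sup>2"
    by (simp add: power_mult_distrib)
qed

section \<open>A physically consistent test parameter\<close>

definition unit_inertia :: "real^10" where
  "unit_inertia = (\<chi> i. if i \<in> {1, 5, 6, 7} then 1 else 0)"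

lemma ip_unit_inertia:
  "ip_mass unit_inertia = 1" "ip_moment unit_inertia = 0" "ip_inertia unit_inertia = mat 1"
  by (simp_all add: unit_inertia_def ip_mass_def ip_moment_def ip_inertia_def vec_eq_iff forall_3
      mat_def)

lemma pos_def_pseudo_unit_inertia: "pos_def (pseudo_inertia unit_inertia)"
proof -
  \<comment> \<open>The value 1/2 is half the trace of the identity inertia minus its diagonal
    entry, 3/2 - 1; the last entry is the unit mass.\<close>
  define d :: "3 + 1 \<Rightarrow> real" where "d i = (case i of Inl _ \<Rightarrow> 1/2 | Inr _ \<Rightarrow> 1)" for i
  have f: "pseudo_inertia unit_inertia = (\<chi> i j. if i = j then d i else 0)"
    by (auto simp: pseudo_inertia_def block_def ip_unit_inertia vec_eq_iff mat_def d_def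
        trace_def sum_3 columnvector_def rowvector_def split: sum.splits)
  have "x \<bullet> (pseudo_inertia unit_inertia *v x) > 0" if "x \<noteq> 0" for x
  proof -
    have pos: "d i > 0" for i
      by (auto simp: d_def split: sum.splits)
    obtain k where "x $ k \<noteq> 0"
      using \<open>x \<noteq> 0\<close> by (auto simp: vec_eq_iff)
    then have "0 < (\<Sum>i\<in>UNIV. d i * (x $ i)\<^sup>2)"
      using pos by (intro sum_pos2[of _ k]) (auto simp: less_imp_le)
    also have "\<dots> = x \<bullet> (pseudo_inertia unit_inertia *v x)"
      by (simp add: f matrix_vector_mult_def inner_vec_def if_distrib[of "\<lambda>a. a * _"]
          cong: if_cong) (simp add: power2_eq_square mult_ac)
    finally show ?thesis .
  qed
  then show ?thesis
    by (auto simp: pos_def_def f transpose_def vec_eq_iff)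
qed

lemma spatial_inertias_unit_inertia: "spatial_inertias (\<chi> l. unit_inertia) = mat 1"
proof -
  have "skew 0 = 0"
    by (simp add: skew_def matrix_def vec_eq_iff)
  then show ?thesis
    by (simp add: spatial_inertias_def spatial_inertia_def ip_unit_inertia block_mat block_diag_mat
        transpose_def flip: zero_vec_def)
qed

section \<open>Bounding the mass matrix\<close>

lemma mass_matrix_congruence:
  "mass_matrix R E F q \<Theta> =
     transpose (chain_transform R E F q ** jacobian F (at q)) ** spatial_inertias \<Theta>
       ** (chain_transform R E F q ** jacobian F (at q))"
  by (simp add: mass_matrix_def matrix_transpose_mul matrix_mul_assoc)

theorem theorem4:
  fixes R E :: "real^3 \<Rightarrow> real^3^3"
    and F :: "real^'n \<Rightarrow> real^('b::finite \<times> (3 + 3))"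
    and \<Theta> \<Theta>' :: "real \<Rightarrow> real^10^'b"
  assumes rot: "\<And>\<phi>. rotation_matrix (R \<phi>)"
    and R_diff: "\<And>\<phi>. R differentiable (at \<phi>)"
    and ang: "angular_velocity_map R E"
    and F_diff: "\<And>q. F differentiable (at q)"
    and M_bdd: "\<And>\<Theta>\<^sub>0 :: real^10^'b. (\<And>l. pos_def (pseudo_inertia (\<Theta>\<^sub>0 $ l))) \<Longrightarrow>
                  bdd_above (range (\<lambda>q. lambda_max (mass_matrix R E F q \<Theta>\<^sub>0)))"
    and \<Theta>_deriv: "\<And>t. t \<ge> 0 \<Longrightarrow> (\<Theta> has_vector_derivative \<Theta>' t) (at t within {0..})"
    and rates_bdd: "\<And>l. bdd_above ((\<lambda>t. sigma_max (pseudo_inertia (\<Theta>' t $ l))) ` {0..})"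
  shows "let chi = sqrt (69 * real CARD('b))
                 * (MAX l. SUP t\<in>{0..}. sigma_max (pseudo_inertia (\<Theta>' t $ l)))
                 * (SUP q. (sigma_max (chain_transform R E F q ** jacobian F (at q)))\<^sup>2)
         in bdd_above (range (\<lambda>q. (sigma_max (chain_transform R E F q ** jacobian F (at q)))\<^sup>2))
            \<and> 0 \<le> chi
            \<and> (\<forall>q. \<forall>t\<ge>0. sigma_max (mass_matrix R E F q (\<Theta>' t)) \<le> chi)"
proof -
  define \<sigma> where "\<sigma> q = (sigma_max (chain_transform R E F q ** jacobian F (at q)))\<^sup>2" for q
  define \<rho> where "\<rho> l = (SUP t\<in>{0..}. sigma_max (pseudo_inertia (\<Theta>' t $ l)))" for l
  define s where "s = (MAX l. \<rho> l)"
  \<comment> \<open>With identity spatial inertias the mass matrix is a Gram matrix, so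
    \<open>M_bdd\<close> at this parameter is exactly boundedness of
    \<open>\<sigma>\<close>.\<close>
  have "lambda_max (mass_matrix R E F q (\<chi> l. unit_inertia)) = \<sigma> q" for q
    by (simp add: mass_matrix_congruence spatial_inertias_unit_inertia lambda_max_gram
        sigma_max_eq_onorm \<sigma>_def)
  then have bdd: "bdd_above (range \<sigma>)"
    using M_bdd[of "\<chi> l. unit_inertia"] by (simp add: pos_def_pseudo_unit_inertia)
  have \<sigma>_le: "\<sigma> q \<le> (SUP q. \<sigma> q)" for q
    by (intro cSUP_upper bdd) simp
  have \<sigma>_nonneg: "0 \<le> \<sigma> q" for q
    by (simp add: \<sigma>_def)
  \<comment> \<open>One bound valid for all bodies and all times: each supremum is a genuine upper
    bound by \<open>rates_bdd\<close>, and there are finitely many bodies.\<close>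
  have rate: "sigma_max (pseudo_inertia (\<Theta>' t $ l)) \<le> s" if "t \<ge> 0" for t l
  proof -
    have "sigma_max (pseudo_inertia (\<Theta>' t $ l)) \<le> \<rho> l"
      unfolding \<rho>_def using that by (intro cSUP_upper rates_bdd) simp
    also have "\<rho> l \<le> s"
      unfolding s_def by (intro Max_ge) auto
    finally show ?thesis .
  qed
  \<comment> \<open>Taken from the rate bound at \<open>t = 0\<close>; this sign is needed to
    multiply the two estimates below.\<close>
  have s: "0 \<le> s"
    using order_trans[OF sigma_max_nonneg rate[OF order_refl]] .
  have "sigma_max (mass_matrix R E F q (\<Theta>' t)) \<le> sqrt (69 * real CARD('b)) * s * (SUP q. \<sigma> q)"
    if "t \<ge> 0" for q t
  proof -
    have "sigma_max (mass_matrix R E F q (\<Theta>' t)) \<le> norm (spatial_inertias (\<Theta>' t)) * \<sigma> q"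
      unfolding mass_matrix_congruence \<sigma>_def by (rule sigma_max_congruence_le)
    also have "\<dots> \<le> sqrt (69 * real CARD('b)) * s * (SUP q. \<sigma> q)"
      using s by (intro mult_mono norm_spatial_inertias_le rate that \<sigma>_le \<sigma>_nonneg) auto
    finally show ?thesis .
  qed
  moreover have "0 \<le> sqrt (69 * real CARD('b)) * s * (SUP q. \<sigma> q)"
    using s order_trans[OF \<sigma>_nonneg \<sigma>_le] by simp
  ultimately show ?thesis
    using bdd unfolding Let_def \<sigma>_def \<rho>_def s_def by blast
qed

end
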